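(* Let $q$ be a prime power, let $n\ge1$ with $q=n+1$, and let $\alpha\in\mathbb{F}_{q^n}$ be normal over $\mathbb{F}_q$. Then there are no $(\alpha,2)$-sociable elements of $\mathbb{F}_{q^n}$.
   Context: An element $\alpha\in\mathbb{F}_{q^n}$ is normal (over $\mathbb{F}_q$) if $\alpha,\alpha^q,\ldots,\alpha^{q^{n-1}}$ are linearly independent over $\mathbb{F}_q$. An element $\beta\in\mathbb{F}_{q^n}$ has normal $\alpha$-depth $2$ if $\beta$ and $\beta-\alpha$ are both normal over $\mathbb{F}_q$. The element $\beta$ is $(\alpha,2)$-sociable if $\beta^{q^i}$ has normal $\alpha$-depth $2$ for all $i\ge0$. *)

theory Defs
  imports "HOL-Algebra.Embedded_Algebras" "HOL-Number_Theory.Prime_Powers"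
begin

text \<open>
  Throughout, \<open>L\<close> is the field with \<open>q ^ n\<close> elements and \<open>F\<close> its subfield with \<open>q\<close>
  elements. These conditions are hypotheses of the theorem, not part of the definitions.
  Independence of a list, in the sense of \<^const>\<open>ring.independent\<close>, includes distinctness
  of its entries.
\<close>

definition normal_element ::
    "('a, 'b) ring_scheme \<Rightarrow> 'a set \<Rightarrow> nat \<Rightarrow> nat \<Rightarrow> 'a \<Rightarrow> bool" where
  "normal_element L F q n x \<longleftrightarrow>
     x \<in> carrier L \<and>
     ring.independent L F (map (\<lambda>i. x [^]\<^bsub>L\<^esub> (q ^ i)) [0..<n])"

definition normal_depth2 ::
    "('a, 'b) ring_scheme \<Rightarrow> 'a set \<Rightarrow> nat \<Rightarrow> nat \<Rightarrow> 'a \<Rightarrow> 'a \<Rightarrow> bool" where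
  "normal_depth2 L F q n \<alpha> \<beta> \<longleftrightarrow>
     normal_element L F q n \<beta> \<and> normal_element L F q n (\<beta> \<ominus>\<^bsub>L\<^esub> \<alpha>)"

definition sociable2 ::
    "('a, 'b) ring_scheme \<Rightarrow> 'a set \<Rightarrow> nat \<Rightarrow> nat \<Rightarrow> 'a \<Rightarrow> 'a \<Rightarrow> bool" where
  "sociable2 L F q n \<alpha> \<beta> \<longleftrightarrow>
     (\<forall>i::nat. normal_depth2 L F q n \<alpha> (\<beta> [^]\<^bsub>L\<^esub> (q ^ i)))"

end

theory Submission
  imports Defs "HOL-Algebra.Multiplicative_Group"
begin

text \<open>
  Since \<open>n = q - 1\<close>, the polynomial \<open>X\<^sup>n - 1\<close> splits over \<open>F\<close> with the nonzero elements of \<open>F\<close>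
  as its simple roots, so the Frobenius map \<open>x \<mapsto> x\<^sup>q\<close> of \<open>L\<close> is diagonalizable over \<open>F\<close>, with
  one eigenline for every nonzero element of \<open>F\<close>. An element is normal iff none of its
  components along these eigenlines vanishes. Take a generator \<open>c\<close> of the multiplicative group
  of \<open>F\<close>, and look only at the component for the eigenvalue \<open>c\<^sup>-\<^sup>1\<close>, which up to a scalar
  is the resolvent \<open>T x = (\<Sum>i<n. c\<^sup>i x\<^bsup>q^i\<^esup>)\<close>.

  For normal \<open>\<alpha>\<close> and \<open>\<beta>\<close>, \<open>T \<alpha>\<close> and \<open>T \<beta>\<close> are nonzero (\<open>resolvent_normal_nonzero\<close>) and lie on
  the same eigenline, so they differ by a nonzero factor from \<open>F\<close>
  (\<open>eigenvector_ratio\<close>, \<open>subfield_eq_roots_of_unity\<close>). This factor is a power \<open>c\<^sup>j\<close>. Passing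
  from \<open>\<beta>\<close> to its \<open>j\<close>-th conjugate multiplies \<open>T \<beta>\<close> by \<open>c\<^bsup>-j\<^esup>\<close>
  (\<open>resolvent_shift_iterate\<close>), which cancels the factor exactly. As \<open>T\<close> is additive, it
  vanishes on the difference of this conjugate and \<open>\<alpha>\<close>, which is therefore not normal: one of
  the conjugates of \<open>\<beta>\<close> fails to have depth 2.
\<close>

section \<open>The Frobenius endomorphism of a finite field\<close>

lemma (in cring) binomial_expansion:
  assumes x: "x \<in> carrier R" and y: "y \<in> carrier R"
  shows "(x \<oplus> y) [^] m = (\<Oplus>k\<in>{..m}. [(m choose k)] \<cdot> (x [^] k \<otimes> y [^] (m - k)))"
proof (induction m)
  case 0
  then show ?case using x y by simp
next
  case (Suc m)
  define t where "t m k = [(m choose k)] \<cdot> (x [^] k \<otimes> y [^] (m - k))" for m k :: nat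
  have t_closed [simp]: "t m k \<in> carrier R" for m k
    using x y by (simp add: t_def)
  have y_t: "t m k \<otimes> y = [(m choose k)] \<cdot> (x [^] k \<otimes> y [^] (Suc m - k))" if "k \<le> m" for k
    using x y that by (simp add: t_def add_pow_ldistr m_assoc Suc_diff_le)
  have x_t: "t m k \<otimes> x = [(m choose k)] \<cdot> (x [^] Suc k \<otimes> y [^] (m - k))" for k
    using x y by (simp add: t_def m_comm[of _ x] add_pow_rdistr m_ac)
  have "(x \<oplus> y) [^] Suc m = (\<Oplus>k\<in>{..m}. t m k) \<otimes> (x \<oplus> y)"
    using Suc.IH by (simp add: t_def)
  also have "\<dots> = (\<Oplus>k\<in>{..m}. t m k \<otimes> x) \<oplus> (\<Oplus>k\<in>{..m}. t m k \<otimes> y)"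
    using x y by (simp add: r_distr finsum_ldistr)
  also have "(\<Oplus>k\<in>{..m}. t m k \<otimes> y)
      = (\<Oplus>k\<in>{..Suc m}. [(m choose k)] \<cdot> (x [^] k \<otimes> y [^] (Suc m - k)))"
  proof -
    have "(\<Oplus>k\<in>{..m}. t m k \<otimes> y)
        = (\<Oplus>k\<in>{..m}. [(m choose k)] \<cdot> (x [^] k \<otimes> y [^] (Suc m - k)))"
      using x y by (intro finsum_cong') (auto simp: y_t)
    then show ?thesis
      using x y by (subst finsum_Suc) (auto simp: binomial_eq_0)
  qed
  also have "\<dots> = (\<Oplus>k\<in>{..m}. [(m choose Suc k)] \<cdot> (x [^] Suc k \<otimes> y [^] (m - k)))
      \<oplus> y [^] Suc m"
    using x y by (subst finsum_Suc2) auto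
  also have "(\<Oplus>k\<in>{..m}. t m k \<otimes> x)
      \<oplus> ((\<Oplus>k\<in>{..m}. [(m choose Suc k)] \<cdot> (x [^] Suc k \<otimes> y [^] (m - k))) \<oplus> y [^] Suc m)
      = (\<Oplus>k\<in>{..m}. t m k \<otimes> x \<oplus> [(m choose Suc k)] \<cdot> (x [^] Suc k \<otimes> y [^] (m - k)))
      \<oplus> y [^] Suc m"
    using x y by (subst finsum_addf) (auto simp: a_assoc)
  also have "(\<Oplus>k\<in>{..m}. t m k \<otimes> x \<oplus> [(m choose Suc k)] \<cdot> (x [^] Suc k \<otimes> y [^] (m - k)))
      = (\<Oplus>k\<in>{..m}. t (Suc m) (Suc k))"
    unfolding x_t using x y
    by (intro finsum_cong') (auto simp: t_def add.nat_pow_mult)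
  also have "\<dots> \<oplus> y [^] Suc m = (\<Oplus>k\<in>{..Suc m}. t (Suc m) k)"
    using x y by (subst finsum_Suc2) (auto simp: t_def)
  finally show ?case by (simp add: t_def)
qed

text \<open>
  All binomial coefficients except the two outer ones are divisible by \<open>p\<close>.
\<close>

lemma (in cring) freshmans_dream:
  fixes p :: nat
  assumes p: "prime p" and char: "[p] \<cdot> \<one> = \<zero>"
    and x: "x \<in> carrier R" and y: "y \<in> carrier R"
  shows "(x \<oplus> y) [^] p = x [^] p \<oplus> y [^] p"
proof -
  obtain m where m: "p = Suc (Suc m)"
    using p by (metis prime_gt_1_nat less_natE add_Suc plus_1_eq_Suc)
  have p_mult: "[p] \<cdot> a = \<zero>" if "a \<in> carrier R" for a
  proof -
    have "[p] \<cdot> a = ([p] \<cdot> \<one>) \<otimes> a" using that by (simp add: add_pow_ldistr)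
    then show ?thesis using that char by simp
  qed
  have inner: "[(p choose k)] \<cdot> a = \<zero>" if "0 < k" "k < p" "a \<in> carrier R" for k a
  proof -
    have "p dvd p choose k" using p that by (intro dvd_choose_prime) auto
    then obtain d where "p choose k = p * d" by (auto elim: dvdE)
    then have "[(p choose k)] \<cdot> a = [d] \<cdot> ([p] \<cdot> a)"
      using that by (simp add: add.nat_pow_pow)
    then show ?thesis using that p_mult by simp
  qed
  have "(\<Oplus>k\<in>{..m}. [(p choose Suc k)] \<cdot> (x [^] Suc k \<otimes> y [^] (p - Suc k))) = (\<Oplus>k\<in>{..m}. \<zero>)"
    using x y by (intro finsum_cong' inner) (auto simp: m)
  moreover have "(x \<oplus> y) [^] p
      = x [^] p \<oplus> ((\<Oplus>k\<in>{..m}. [(p choose Suc k)] \<cdot> (x [^] Suc k \<otimes> y [^] (p - Suc k))) \<oplus> y [^] p)"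
    using x y unfolding binomial_expansion[OF x y] m
    by (subst finsum_Suc, simp) (subst finsum_Suc2, auto simp del: binomial_Suc_Suc)
  ultimately show ?thesis using x y by simp
qed

text \<open>
  The element \<open>p\<^sup>k \<cdot> \<one>\<close> is the \<open>k\<close>-th power of \<open>p \<cdot> \<one>\<close>, and a domain has no nilpotents.
  This lets the characteristic be read off from the cardinality of a finite field.
\<close>

lemma (in domain) prime_power_char_imp_prime_char:
  fixes p k :: nat
  assumes "[(p ^ k)] \<cdot> \<one> = \<zero>"
  shows "[p] \<cdot> \<one> = \<zero>"
  using assms
proof (induction k)
  case 0
  then show ?case by simp
next
  case (Suc k)
  have "([p] \<cdot> \<one>) \<otimes> ([(p ^ k)] \<cdot> \<one>) = [(p ^ Suc k)] \<cdot> \<one>"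
    by (simp add: add_pow_ldistr add.nat_pow_pow mult.commute)
  then have "[p] \<cdot> \<one> = \<zero> \<or> [(p ^ k)] \<cdot> \<one> = \<zero>"
    using Suc.prems integral by (metis add.nat_pow_closed one_closed)
  then show ?case using Suc.IH by blast
qed

lemma (in field) frobenius_power_hom:
  assumes q: "primepow q" and n: "card (carrier R) = q ^ n"
  shows "(\<lambda>x. x [^] (q ^ i)) \<in> ring_hom R R"
proof -
  obtain p k where p: "prime p" and k: "q = p ^ k"
    using q by (auto simp: primepow_def)
  \<comment> \<open>Lagrange's theorem in the additive group gives a power of \<open>p\<close> that kills \<open>\<one>\<close>.\<close>
  have "[(card (carrier R))] \<cdot> \<one> = \<zero>"
    using add.pow_order_eq_1[of \<one>] by (simp add: order_def)
  then have char: "[p] \<cdot> \<one> = \<zero>"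
    using prime_power_char_imp_prime_char[of p "k * n"] n by (simp add: k power_mult)
  have "(x \<oplus> y) [^] (p ^ j) = x [^] (p ^ j) \<oplus> y [^] (p ^ j)"
    if "x \<in> carrier R" "y \<in> carrier R" for x y j
  proof (induction j)
    case 0
    then show ?case using that by simp
  next
    case (Suc j)
    have "(x \<oplus> y) [^] (p ^ Suc j) = ((x \<oplus> y) [^] (p ^ j)) [^] p"
      using that by (simp add: nat_pow_pow mult.commute)
    also have "\<dots> = (x [^] (p ^ j)) [^] p \<oplus> (y [^] (p ^ j)) [^] p"
      using that Suc.IH freshmans_dream[OF p char] by simp
    finally show ?case using that by (simp add: nat_pow_pow mult.commute)
  qed
  then show ?thesis
    by (auto intro!: ring_hom_memI simp: nat_pow_distrib k simp flip: power_mult)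
qed

section \<open>The multiplicative group of a finite subfield\<close>

lemma (in field) finite_field_pow_card:
  assumes fin: "finite (carrier R)" and x: "x \<in> carrier R"
  shows "x [^] card (carrier R) = x"
proof (cases "x = \<zero>")
  case True
  then show ?thesis using fin x nat_pow_zero[of "card (carrier R)"] by auto
next
  case False
  interpret G: group "mult_of R" by (rule field_mult_group)
  have "x [^] (card (carrier R) - 1) = \<one>"
    using G.pow_order_eq_1[of x] x False fin by (simp add: order_mult_of order_def nat_pow_mult_of)
  moreover have "card (carrier R) = Suc (card (carrier R) - 1)"
    using fin x by (metis Suc_pred' card_gt_0_iff empty_iff)
  ultimately show ?thesis using x by (metis l_one nat_pow_Suc)
qed

lemma (in field) subfield_generator:
  assumes K: "subfield K R" and fin: "finite K"
  obtains c where "c \<in> K - {\<zero>}" and "K - {\<zero>} = range (\<lambda>j::nat. c [^] j)"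
proof -
  interpret K: field "R\<lparr>carrier := K\<rparr>" by (rule subfield_iff(2)[OF K])
  have "\<exists>c\<in>K - {\<zero>}. K - {\<zero>} = {c [^]\<^bsub>R\<lparr>carrier := K\<rparr>\<^esub> i | i::nat. i \<in> UNIV}"
    using K.finite_field_mult_group_has_gen fin by simp
  then obtain c where "c \<in> K - {\<zero>}" "K - {\<zero>} = {c [^]\<^bsub>R\<lparr>carrier := K\<rparr>\<^esub> i | i::nat. i \<in> UNIV}"
    by blast
  then show ?thesis
    by (intro that[of c]) (simp_all add: nat_pow_consistent[symmetric] full_SetCompr_eq)
qed

text \<open>
  Lagrange's theorem in the multiplicative group of \<open>K\<close> gives one inclusion. Equality follows by
  counting, because \<open>X\<^sup>n - 1\<close> has at most \<open>n\<close> roots in \<open>R\<close>. This is how elements of \<open>R\<close> are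
  recognised as lying in \<open>K\<close>.
\<close>

lemma (in field) subfield_eq_roots_of_unity:
  assumes K: "subfield K R" and fin: "finite (carrier R)" and card: "card K = Suc n" and n: "n \<ge> 1"
  shows "K - {\<zero>} = {x \<in> carrier R. x [^] n = \<one>}"
proof (rule card_subset_eq)
  have sub: "K \<subseteq> carrier R" by (rule subfieldE(3)[OF K])
  have zero: "\<zero> \<in> K" by (rule subringE(2)[OF subfieldE(1)[OF K]])
  have finK: "finite K" using sub fin by (rule finite_subset)
  interpret K: field "R\<lparr>carrier := K\<rparr>" by (rule subfield_iff(2)[OF K])
  show "finite {x \<in> carrier R. x [^] n = \<one>}" using fin by simp
  show subset: "K - {\<zero>} \<subseteq> {x \<in> carrier R. x [^] n = \<one>}"
  proof
    fix x assume x: "x \<in> K - {\<zero>}"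
    have "x [^] Suc n = x"
      using K.finite_field_pow_card[of x] finK x card by (simp add: nat_pow_consistent[symmetric])
    then have "x [^] n \<otimes> x = \<one> \<otimes> x" using x sub by auto
    then show "x \<in> {x \<in> carrier R. x [^] n = \<one>}"
      using x sub m_rcancel[of x "x [^] n" \<one>] by auto
  qed
  have "card (K - {\<zero>}) = n" using card finK zero by simp
  moreover have "card {x \<in> carrier R. x [^] n = \<one>} \<le> n"
    using num_roots_le_deg[OF fin] n by simp
  ultimately show "card (K - {\<zero>}) = card {x \<in> carrier R. x [^] n = \<one>}"
    using card_mono[OF _ subset] fin by simp
qed

section \<open>Resolvents\<close>

text \<open>
  This is the Lagrange resolvent for the Frobenius map. In a field with \<open>q\<^sup>n\<close> elements whose
  characteristic does not divide \<open>n\<close>, if \<open>c\<^sup>n = 1\<close> and \<open>c\<close> is fixed by the Frobenius map, it is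
  \<open>n\<close> times the projection onto the eigenspace for the eigenvalue \<open>c\<^sup>-\<^sup>1\<close>.
\<close>

definition resolvent :: "('a, 'b) ring_scheme \<Rightarrow> nat \<Rightarrow> nat \<Rightarrow> 'a \<Rightarrow> 'a \<Rightarrow> 'a" where
  "resolvent L q n c x = (\<Oplus>\<^bsub>L\<^esub>i\<in>{..<n}. c [^]\<^bsub>L\<^esub> i \<otimes>\<^bsub>L\<^esub> x [^]\<^bsub>L\<^esub> (q ^ i))"

lemma (in ring) combine_map_upt:
  assumes "f \<in> {..<n} \<rightarrow> carrier R" and "g \<in> {..<n} \<rightarrow> carrier R"
  shows "combine (map f [0..<n]) (map g [0..<n]) = (\<Oplus>i\<in>{..<n}. f i \<otimes> g i)"
  using assms
proof (induction n)
  case 0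
  then show ?case by simp
next
  case (Suc n)
  have "combine (map f [0..<Suc n]) (map g [0..<Suc n])
      = combine (map f [0..<n]) (map g [0..<n]) \<oplus> combine [f n] [g n]"
    using Suc.prems by (subst combine_append) (auto simp: Pi_iff)
  also have "combine (map f [0..<n]) (map g [0..<n]) = (\<Oplus>i\<in>{..<n}. f i \<otimes> g i)"
    using Suc.prems by (intro Suc.IH) auto
  finally show ?case
    using Suc.prems by (subst lessThan_Suc, subst finsum_insert) (auto simp: Pi_iff a_comm)
qed

text \<open>
  The resolvent is a linear combination over \<open>K\<close> of the conjugates of \<open>x\<close>, and it is nontrivial
  because its first coefficient is \<open>c\<^sup>0 = \<one>\<close>.
\<close>

lemma (in field) resolvent_normal_nonzero:
  assumes K: "subfield K R" and c: "c \<in> K" and n: "n \<ge> 1" and x: "normal_element R K q n x"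
  shows "resolvent R q n c x \<noteq> \<zero>"
proof
  assume zero: "resolvent R q n c x = \<zero>"
  let ?cs = "map (\<lambda>i. c [^] i) [0..<n]" and ?xs = "map (\<lambda>i. x [^] (q ^ i)) [0..<n]"
  have x_closed: "x \<in> carrier R" and indep: "independent K ?xs"
    using x by (auto simp: normal_element_def)
  have sub: "K \<subseteq> carrier R" by (rule subfieldE(3)[OF K])
  interpret K: field "R\<lparr>carrier := K\<rparr>" by (rule subfield_iff(2)[OF K])
  have "c [^] i \<in> K" for i :: nat
    using K.nat_pow_closed[of c i] c by (simp add: nat_pow_consistent[symmetric])
  then have cs: "set ?cs \<subseteq> K" by auto
  have "combine ?cs ?xs = \<zero>"
    using zero c sub x_closed by (subst combine_map_upt) (auto simp: resolvent_def)
  then have "set (take (length ?xs) ?cs) \<subseteq> {\<zero>}"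
    by (rule independent_imp_trivial_combine[OF K indep cs])
  moreover have "\<one> \<in> set ?cs" using n by (force intro!: image_eqI[of _ _ 0])
  ultimately show False by auto
qed


lemma (in cring) resolvent_closed [simp]:
  assumes "c \<in> carrier R" and "x \<in> carrier R"
  shows "resolvent R q n c x \<in> carrier R"
  using assms by (auto simp: resolvent_def)

lemma (in cring) resolvent_add:
  assumes hom: "\<And>i. (\<lambda>x. x [^] (q ^ i)) \<in> ring_hom R R"
    and c: "c \<in> carrier R" and x: "x \<in> carrier R" and y: "y \<in> carrier R"
  shows "resolvent R q n c (x \<oplus> y) = resolvent R q n c x \<oplus> resolvent R q n c y"
proof -
  have add: "(x \<oplus> y) [^] (q ^ i) = x [^] (q ^ i) \<oplus> y [^] (q ^ i)" for i
    using ring_hom_add[OF hom[of i]] x y by simp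
  show ?thesis
    unfolding resolvent_def add using c x y
    by (subst finsum_addf[symmetric]) (auto intro!: finsum_cong' simp: r_distr)
qed

lemma (in cring) resolvent_power:
  assumes hom: "\<And>i. (\<lambda>x. x [^] (q ^ i)) \<in> ring_hom R R"
    and c: "c \<in> carrier R" and c_fixed: "c [^] q = c" and x: "x \<in> carrier R"
  shows "resolvent R q n c (x [^] q) = resolvent R q n c x [^] q"
proof -
  interpret frob: ring_hom_cring R R "\<lambda>x. x [^] q"
    using hom[of 1] by unfold_locales simp
  have "(c [^] i \<otimes> x [^] (q ^ i)) [^] q = c [^] i \<otimes> (x [^] q) [^] (q ^ i)" for i :: nat
  proof -
    have "(c [^] i \<otimes> x [^] (q ^ i)) [^] q = (c [^] q) [^] i \<otimes> (x [^] q) [^] (q ^ i)"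
      using c x by (simp add: nat_pow_distrib nat_pow_pow mult.commute)
    then show ?thesis by (simp add: c_fixed)
  qed
  then show ?thesis
    using c x frob.hom_finsum[of "\<lambda>i. c [^] i \<otimes> x [^] (q ^ i)" "{..<n}"]
    by (auto simp: resolvent_def comp_def intro!: finsum_cong')
qed

text \<open>
  Multiplication by \<open>c\<close> and replacing \<open>x\<close> by \<open>x\<^sup>q\<close> both move the \<open>i\<close>-th summand to the next one;
  the last summand wraps around to the first. Together with the lemma \<open>resolvent_power\<close>, this says
  that the resolvent is an eigenvector of the Frobenius map with eigenvalue \<open>c\<^sup>-\<^sup>1\<close>.
\<close>

lemma (in cring) resolvent_shift:
  assumes c: "c \<in> carrier R" and x: "x \<in> carrier R"
    and c_root: "c [^] n = \<one>" and x_fixed: "x [^] (q ^ n) = x"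
  shows "c \<otimes> resolvent R q n c (x [^] q) = resolvent R q n c x"
proof -
  define t where "t i = c [^] i \<otimes> x [^] (q ^ i)" for i :: nat
  have t_closed [simp]: "t i \<in> carrier R" for i using c x by (simp add: t_def)
  have telescope: "t 0 \<oplus> (\<Oplus>i\<in>{..<n}. t (Suc i)) = t n \<oplus> (\<Oplus>i\<in>{..<n}. t i)" for n
  proof (induction n)
    case (Suc n)
    have "t 0 \<oplus> (\<Oplus>i\<in>{..<Suc n}. t (Suc i)) = t (Suc n) \<oplus> (t 0 \<oplus> (\<Oplus>i\<in>{..<n}. t (Suc i)))"
      by (simp add: lessThan_Suc a_lcomm Pi_iff)
    also have "\<dots> = t (Suc n) \<oplus> (\<Oplus>i\<in>{..<Suc n}. t i)"
      by (subst Suc.IH) (simp add: lessThan_Suc Pi_iff)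
    finally show ?case .
  qed simp
  have wrap: "t n = t 0" using c x by (simp add: t_def c_root x_fixed)
  have "c \<otimes> resolvent R q n c (x [^] q)
      = (\<Oplus>i\<in>{..<n}. c \<otimes> (c [^] i \<otimes> (x [^] q) [^] (q ^ i)))"
    unfolding resolvent_def using c x by (intro finsum_rdistr) auto
  also have "\<dots> = (\<Oplus>i\<in>{..<n}. t (Suc i))"
    using c x by (intro finsum_cong') (auto simp: t_def nat_pow_pow m_ac)
  also have "\<dots> = (\<Oplus>i\<in>{..<n}. t i)"
    using telescope[of n] wrap by (simp add: Pi_iff)
  finally show ?thesis by (simp add: resolvent_def t_def)
qed

lemma (in cring) resolvent_shift_iterate:
  assumes c: "c \<in> carrier R" and x: "x \<in> carrier R"
    and c_root: "c [^] n = \<one>" and fixed: "\<And>x. x \<in> carrier R \<Longrightarrow> x [^] (q ^ n) = x"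
  shows "c [^] j \<otimes> resolvent R q n c (x [^] (q ^ j)) = resolvent R q n c x"
proof (induction j)
  case 0
  then show ?case using c x by simp
next
  case (Suc j)
  let ?y = "x [^] (q ^ j)"
  have "c [^] Suc j \<otimes> resolvent R q n c (x [^] (q ^ Suc j))
      = c [^] j \<otimes> (c \<otimes> resolvent R q n c (?y [^] q))"
    using c x by (simp add: m_assoc nat_pow_pow mult.commute)
  also have "\<dots> = c [^] j \<otimes> resolvent R q n c ?y"
    using c x c_root fixed by (simp add: resolvent_shift)
  finally show ?case using Suc.IH by simp
qed

text \<open>
  With \<open>q = Suc n\<close>, two nonzero eigenvectors of the Frobenius map for the eigenvalue \<open>c\<^sup>-\<^sup>1\<close> have
  a ratio fixed by that map. The ratio is nonzero, so being fixed means being an \<open>n\<close>-th root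
  of unity.
\<close>

lemma (in field) eigenvector_ratio:
  assumes c: "c \<in> carrier R" "c \<noteq> \<zero>"
    and u: "u \<in> carrier R" "u \<noteq> \<zero>" "c \<otimes> u [^] Suc n = u"
    and v: "v \<in> carrier R" "v \<noteq> \<zero>" "c \<otimes> v [^] Suc n = v"
  obtains r where "r \<in> carrier R" and "r [^] n = \<one>" and "v = r \<otimes> u"
proof -
  have power: "c \<otimes> w [^] n = \<one>" if w: "w \<in> carrier R" "w \<noteq> \<zero>" "c \<otimes> w [^] Suc n = w" for w
  proof -
    have "(c \<otimes> w [^] n) \<otimes> w = \<one> \<otimes> w" using w c by (simp add: m_assoc)
    then show ?thesis using w c m_rcancel[of w "c \<otimes> w [^] n" \<one>] by simp
  qed
  have inv_u: "inv u \<in> carrier R" "inv u \<otimes> u = \<one>"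
    using u field_Units by auto
  show ?thesis
  proof (rule that)
    show "v \<otimes> inv u \<in> carrier R" using v inv_u by simp
    show "v = (v \<otimes> inv u) \<otimes> u" using v inv_u u by (simp add: m_assoc)
    have "(v \<otimes> inv u) [^] n = (c \<otimes> u [^] n) \<otimes> (v \<otimes> inv u) [^] n"
      using power[OF u] v inv_u by simp
    also have "\<dots> = (c \<otimes> v [^] n) \<otimes> (inv u \<otimes> u) [^] n"
      using c u(1) v(1) inv_u(1) by (simp add: nat_pow_distrib m_ac)
    finally show "(v \<otimes> inv u) [^] n = \<one>"
      using power[OF v] inv_u by simp
  qed
qed

theorem proposition8:
  fixes L :: "('a, 'b) ring_scheme" and F :: "'a set" and q n :: nat and \<alpha> :: 'a
  assumes "primepow q"
    and "n \<ge> 1"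
    and "q = n + 1"
    and "field L"
    and "card (carrier L) = q ^ n"
    and "subfield F L"
    and "card F = q"
    and "\<alpha> \<in> carrier L"
    and "normal_element L F q n \<alpha>"
  shows "\<not> (\<exists>\<beta> \<in> carrier L. sociable2 L F q n \<alpha> \<beta>)"
proof
  assume "\<exists>\<beta> \<in> carrier L. sociable2 L F q n \<alpha> \<beta>"
  then obtain \<beta> where \<beta>: "\<beta> \<in> carrier L" and sociable: "sociable2 L F q n \<alpha> \<beta>" by blast
  interpret L: field L by fact
  have q: "q = Suc n" using assms by simp
  have fin: "finite (carrier L)" using assms by (intro card_ge_0_finite) simp
  have F_sub: "F \<subseteq> carrier L" using assms(6) by (rule subfieldE(3))
  have hom: "(\<lambda>x. x [^]\<^bsub>L\<^esub> (q ^ i)) \<in> ring_hom L L" for i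
    using assms by (intro L.frobenius_power_hom)
  have fixed: "x [^]\<^bsub>L\<^esub> (q ^ n) = x" if "x \<in> carrier L" for x
    using L.finite_field_pow_card[OF fin that] assms(5) by simp
  have roots: "F - {\<zero>\<^bsub>L\<^esub>} = {x \<in> carrier L. x [^]\<^bsub>L\<^esub> n = \<one>\<^bsub>L\<^esub>}"
    using assms fin q by (intro L.subfield_eq_roots_of_unity) auto
  obtain c where c: "c \<in> F - {\<zero>\<^bsub>L\<^esub>}" and gen: "F - {\<zero>\<^bsub>L\<^esub>} = range (\<lambda>j::nat. c [^]\<^bsub>L\<^esub> j)"
    using L.subfield_generator[OF assms(6)] fin F_sub finite_subset by metis
  then have c_closed: "c \<in> carrier L" and c_root: "c [^]\<^bsub>L\<^esub> n = \<one>\<^bsub>L\<^esub>"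
    using F_sub roots by auto
  have c_fixed: "c [^]\<^bsub>L\<^esub> q = c" using c_closed c_root by (simp add: q)
  let ?T = "resolvent L q n c"
  have nonzero: "?T x \<noteq> \<zero>\<^bsub>L\<^esub>" if "normal_element L F q n x" for x
    using assms(2,6) c that by (intro L.resolvent_normal_nonzero) auto
  have eigen: "c \<otimes>\<^bsub>L\<^esub> ?T x [^]\<^bsub>L\<^esub> Suc n = ?T x" if "x \<in> carrier L" for x
    using L.resolvent_power[OF hom c_closed c_fixed that]
      L.resolvent_shift[OF c_closed that c_root fixed[OF that]] q by simp
  have normal: "normal_element L F q n (\<beta> [^]\<^bsub>L\<^esub> (q ^ j))"
    "normal_element L F q n (\<beta> [^]\<^bsub>L\<^esub> (q ^ j) \<ominus>\<^bsub>L\<^esub> \<alpha>)" for j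
    using sociable by (auto simp: sociable2_def normal_depth2_def)
  \<comment> \<open>\<open>T \<alpha>\<close> and \<open>T \<beta>\<close> span the same eigenline, so their ratio is a power of \<open>c\<close>.\<close>
  have "?T \<alpha> \<noteq> \<zero>\<^bsub>L\<^esub>" "?T \<beta> \<noteq> \<zero>\<^bsub>L\<^esub>"
    using nonzero[OF assms(9)] nonzero[OF normal(1)[of 0]] \<beta> by auto
  then obtain r where "r \<in> carrier L" "r [^]\<^bsub>L\<^esub> n = \<one>\<^bsub>L\<^esub>" and r: "?T \<beta> = r \<otimes>\<^bsub>L\<^esub> ?T \<alpha>"
    using L.eigenvector_ratio[of c "?T \<alpha>" n "?T \<beta>"] c c_closed \<beta> assms(8) eigen by auto
  then have "r \<in> range (\<lambda>j::nat. c [^]\<^bsub>L\<^esub> j)" using roots gen by auto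
  then obtain j :: nat where j: "r = c [^]\<^bsub>L\<^esub> j" by auto
  \<comment> \<open>The \<open>j\<close>-th conjugate of \<open>\<beta>\<close> is the one whose resolvent agrees with that of \<open>\<alpha>\<close>.\<close>
  let ?\<gamma> = "\<beta> [^]\<^bsub>L\<^esub> (q ^ j)"
  have \<gamma>: "?\<gamma> \<in> carrier L" using \<beta> by simp
  have "r \<noteq> \<zero>\<^bsub>L\<^esub>" using gen j by auto
  moreover have "r \<otimes>\<^bsub>L\<^esub> ?T ?\<gamma> = r \<otimes>\<^bsub>L\<^esub> ?T \<alpha>"
    using L.resolvent_shift_iterate[OF c_closed \<beta> c_root fixed, of j] r j by simp
  ultimately have "?T ?\<gamma> = ?T \<alpha>"
    using \<open>r \<in> carrier L\<close> \<gamma> c_closed assms(8) by (simp add: L.m_lcancel)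
  moreover have "?T ?\<gamma> = ?T (?\<gamma> \<ominus>\<^bsub>L\<^esub> \<alpha>) \<oplus>\<^bsub>L\<^esub> ?T \<alpha>"
    using L.resolvent_add[OF hom c_closed, of "?\<gamma> \<ominus>\<^bsub>L\<^esub> \<alpha>" \<alpha>] \<gamma> assms(8)
    by (simp add: L.minus_eq L.a_assoc L.l_neg)
  ultimately have "?T (?\<gamma> \<ominus>\<^bsub>L\<^esub> \<alpha>) = \<zero>\<^bsub>L\<^esub>"
    using \<gamma> c_closed assms(8) by (simp add: L.add.r_cancel_one')
  then show False using nonzero[OF normal(2)] by blast
qed

end
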